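(* Let $A$ be a perm algebra, $E$ a vector space that contains $A$ as a subspace and $V$ a complement of $A$ in $E$. Then: (i) Denote $H^{2}(A,V):=\mathfrak{E}(A,V)/\approx$. The map $H^{2}(A,V)\to \mathrm{Ext}(E,A)$, $\overline{\Omega(A,V)}\mapsto\overline{A\natural V}$, is a bijection, where $\overline{\Omega(A,V)}$ and $\overline{A\natural V}$ are the equivalence classes of $\Omega(A,V)$ and $A\natural V$ under $\approx$, respectively. (ii) Denote $\mathcal{H}^{2}(A,V):=\mathfrak{E}(A,V)/\equiv$. The map $\mathcal{H}^{2}(A,V)\to\mathbf{Ext}(E,A)$, $[\Omega(A,V)]\mapsto[A\natural V]$, is a bijection, where $[\Omega(A,V)]$ and $[A\natural V]$ are the equivalence classes of $\Omega(A,V)$ and $A\natural V$ under $\equiv$, respectively.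
   Context: All vector spaces are over a field $\mathbb{K}$ of characteristic zero. A perm algebra is a vector space $A$ with a bilinear product satisfying $(a_1a_2)a_3=a_1(a_2a_3)=a_1(a_3a_2)$ for all $a_1,a_2,a_3\in A$ (no unit is required). Extending structures. An extending datum of $A$ by a vector space $V$ is a system $\Omega(A,V)=(\blacktriangleright,\blacktriangleleft,\triangleright,\triangleleft,\chi,\cdot)$ of bilinear maps $\blacktriangleright:A\times V\to V$, $\blacktriangleleft:V\times A\to V$, $\triangleright:V\times A\to A$, $\triangleleft:A\times V\to A$, $\chi:V\times V\to A$, $\cdot:V\times V\to V$. Denote by $A\natural V$ the vector space $A\oplus V$ with the product $$(a_1,v_1)\ast(a_2,v_2)=\big(a_1a_2+v_1\triangleright a_2+a_1\triangleleft v_2+\chi(v_1,v_2),\ v_1\cdot v_2+a_1\blacktriangleright v_2+v_1\blacktriangleleft a_2\big).$$ If this is a perm algebra, $\Omega(A,V)$ is called a perm extending structure of $A$ by $V$ and $A\natural V$ the unified product. $\mathfrak{E}(A,V)$ is the set of all perm extending structures of $A$ by $V$. Through the linear isomorphism $A\oplus V\to E$, $(a,v)\mapsto a+v$, a unified product $A\natural V$ is regarded as a perm algebra structure on $E$ containing $A$ as a subalgebra. Relations on $\mathfrak{E}(A,V)$. $\Omega(A,V)=(\blacktriangleright,\blacktriangleleft,\triangleright,\triangleleft,\chi,\cdot)$ and $\Omega'(A,V)=(\blacktriangleright',\blacktriangleleft',\triangleright',\triangleleft',\chi',\cdot')$ are equivalent, $\Omega(A,V)\approx\Omega'(A,V)$,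 if there are a linear map $\lambda:V\to A$ and a linear bijection $\rho:V\to V$ such that for all $a\in A$, $v,v_1,v_2\in V$: $\rho(a\blacktriangleright v)=a\blacktriangleright'\rho(v)$; $a\triangleleft v+\lambda(a\blacktriangleright v)=a\lambda(v)+a\triangleleft'\rho(v)$; $\rho(v\blacktriangleleft a)=\rho(v)\blacktriangleleft' a$; $v\triangleright a+\lambda(v\blacktriangleleft a)=\lambda(v)a+\rho(v)\triangleright' a$; $\rho(v_1\cdot v_2)=\rho(v_1)\cdot'\rho(v_2)+\lambda(v_1)\blacktriangleright'\rho(v_2)+\rho(v_1)\blacktriangleleft'\lambda(v_2)$; $\chi(v_1,v_2)+\lambda(v_1\cdot v_2)=\lambda(v_1)\lambda(v_2)+\rho(v_1)\triangleright'\lambda(v_2)+\lambda(v_1)\triangleleft'\rho(v_2)+\chi'(\rho(v_1),\rho(v_2))$. If these hold with $\rho=\mathrm{id}$ they are called cohomologous, $\Omega(A,V)\equiv\Omega'(A,V)$. Relations on structures on $E$. Let $\iota:A\to E$ be the inclusion and $\pi:E\to V$ the projection along $A$. A linear map $\varphi:E\to E$ stabilizes $A$ if $\varphi\circ\iota=\iota$ and costabilizes $V$ if $\pi\circ\varphi=\pi$. Two perm algebra structures $(E,\diamond)$, $(E,\diamond')$, both containing $A$ as a subalgebra, are equivalent ($\approx$) if there is a perm algebra isomorphism $(E,\diamond)\to(E,\diamond')$ stabilizing $A$, and cohomologous ($\equiv$) if there is one stabilizing $A$ and costabilizing $V$. $\mathrm{Ext}(E,A)$ (resp. $\mathbf{Ext}(E,A)$)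 is the set of classes, under $\approx$ (resp. $\equiv$), of perm algebra structures on $E$ containing $A$ as a subalgebra. *)

theory Defs
  imports "HOL-Analysis.Product_Vector" "HOL-Library.FuncSet"
begin

definition linear_map_on ::
  "('k \<Rightarrow> 'a \<Rightarrow> 'a) \<Rightarrow> ('k \<Rightarrow> 'b \<Rightarrow> 'b) \<Rightarrow> 'a::ab_group_add set \<Rightarrow> 'b::ab_group_add set \<Rightarrow> ('a \<Rightarrow> 'b) \<Rightarrow> bool"
  where "linear_map_on s t U W f \<longleftrightarrow>
    f \<in> U \<rightarrow> W \<and>
    (\<forall>x\<in>U. \<forall>y\<in>U. f (x + y) = f x + f y) \<and>
    (\<forall>c. \<forall>x\<in>U. f (s c x) = t c (f x))"

definition bilinear_map_on ::
  "('k \<Rightarrow> 'a \<Rightarrow> 'a) \<Rightarrow> 'a::ab_group_add set \<Rightarrow> 'a set \<Rightarrow> 'a set \<Rightarrow> ('a \<Rightarrow> 'a \<Rightarrow> 'a) \<Rightarrow> bool"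
  where "bilinear_map_on s U W Z f \<longleftrightarrow>
    (\<forall>x\<in>U. linear_map_on s s W Z (f x)) \<and>
    (\<forall>y\<in>W. linear_map_on s s U Z (\<lambda>x. f x y))"

text \<open>The underlying space of a perm algebra is a linear subspace \<open>A\<close> of the ambient type; the values of
  the product outside \<open>A\<close> are irrelevant.\<close>

locale perm_algebra = vector_space scale
  for scale :: "'k::field_char_0 \<Rightarrow> 'a::ab_group_add \<Rightarrow> 'a" +
  fixes A :: "'a set" and mult :: "'a \<Rightarrow> 'a \<Rightarrow> 'a"
  assumes subspace_carrier: "subspace A"
    and bilinear_mult: "bilinear_map_on scale A A A mult"
    and mult_assoc: "\<lbrakk>x \<in> A; y \<in> A; z \<in> A\<rbrakk> \<Longrightarrow> mult (mult x y) z = mult x (mult y z)"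
    and mult_perm: "\<lbrakk>x \<in> A; y \<in> A; z \<in> A\<rbrakk> \<Longrightarrow> mult x (mult y z) = mult x (mult z y)"


section \<open>Extending structures\<close>

record 'e datum =
  lactV :: "'e \<Rightarrow> 'e \<Rightarrow> 'e"  \<comment> \<open>\<open>A \<times> V \<rightarrow> V\<close>, the filled triangle pointing right\<close>
  ractV :: "'e \<Rightarrow> 'e \<Rightarrow> 'e"  \<comment> \<open>\<open>V \<times> A \<rightarrow> V\<close>, the filled triangle pointing left\<close>
  lactA :: "'e \<Rightarrow> 'e \<Rightarrow> 'e"  \<comment> \<open>\<open>V \<times> A \<rightarrow> A\<close>, the open triangle pointing right\<close>
  ractA :: "'e \<Rightarrow> 'e \<Rightarrow> 'e"  \<comment> \<open>\<open>A \<times> V \<rightarrow> A\<close>, the open triangle pointing left\<close>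
  chi :: "'e \<Rightarrow> 'e \<Rightarrow> 'e"    \<comment> \<open>\<open>V \<times> V \<rightarrow> A\<close>\<close>
  multV :: "'e \<Rightarrow> 'e \<Rightarrow> 'e"  \<comment> \<open>\<open>V \<times> V \<rightarrow> V\<close>\<close>

text \<open>Maps between subspaces are represented by total functions that are \<^term>\<open>undefined\<close> outside
  their domain, so that equality of data is equality of the maps they represent.\<close>

definition extending_datum ::
  "('k \<Rightarrow> 'e \<Rightarrow> 'e) \<Rightarrow> 'e::ab_group_add set \<Rightarrow> 'e set \<Rightarrow> 'e datum \<Rightarrow> bool"
  where "extending_datum s A V \<Omega> \<longleftrightarrow>
    case_prod (lactV \<Omega>) \<in> A \<times> V \<rightarrow>\<^sub>E V \<and> bilinear_map_on s A V V (lactV \<Omega>) \<and>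
    case_prod (ractV \<Omega>) \<in> V \<times> A \<rightarrow>\<^sub>E V \<and> bilinear_map_on s V A V (ractV \<Omega>) \<and>
    case_prod (lactA \<Omega>) \<in> V \<times> A \<rightarrow>\<^sub>E A \<and> bilinear_map_on s V A A (lactA \<Omega>) \<and>
    case_prod (ractA \<Omega>) \<in> A \<times> V \<rightarrow>\<^sub>E A \<and> bilinear_map_on s A V A (ractA \<Omega>) \<and>
    case_prod (chi \<Omega>) \<in> V \<times> V \<rightarrow>\<^sub>E A \<and> bilinear_map_on s V V A (chi \<Omega>) \<and>
    case_prod (multV \<Omega>) \<in> V \<times> V \<rightarrow>\<^sub>E V \<and> bilinear_map_on s V V V (multV \<Omega>)"

definition unified_mult ::
  "('e \<Rightarrow> 'e \<Rightarrow> 'e) \<Rightarrow> 'e datum \<Rightarrow> 'e \<times> 'e \<Rightarrow> 'e \<times> 'e \<Rightarrow> 'e::ab_group_add \<times> 'e"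
  where "unified_mult m \<Omega> = (\<lambda>(a1, v1) (a2, v2).
    (m a1 a2 + lactA \<Omega> v1 a2 + ractA \<Omega> a1 v2 + chi \<Omega> v1 v2,
     multV \<Omega> v1 v2 + lactV \<Omega> a1 v2 + ractV \<Omega> v1 a2))"

definition perm_ext_structures ::
  "('k::field_char_0 \<Rightarrow> 'e \<Rightarrow> 'e) \<Rightarrow> 'e::ab_group_add set \<Rightarrow> ('e \<Rightarrow> 'e \<Rightarrow> 'e) \<Rightarrow> 'e set \<Rightarrow> 'e datum set"
  where "perm_ext_structures s A m V =
    {\<Omega>. extending_datum s A V \<Omega> \<and>
         perm_algebra (module_prod.scale s s) (A \<times> V) (unified_mult m \<Omega>)}"

definition datum_morphism ::
  "('k \<Rightarrow> 'e \<Rightarrow> 'e) \<Rightarrow> 'e::ab_group_add set \<Rightarrow> ('e \<Rightarrow> 'e \<Rightarrow> 'e) \<Rightarrow> 'e set \<Rightarrow>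
   'e datum \<Rightarrow> 'e datum \<Rightarrow> ('e \<Rightarrow> 'e) \<Rightarrow> ('e \<Rightarrow> 'e) \<Rightarrow> bool"
  where "datum_morphism s A m V \<Omega> \<Omega>' l r \<longleftrightarrow>
    linear_map_on s s V A l \<and> linear_map_on s s V V r \<and> bij_betw r V V \<and>
    (\<forall>a\<in>A. \<forall>v\<in>V.
      r (lactV \<Omega> a v) = lactV \<Omega>' a (r v) \<and>
      ractA \<Omega> a v + l (lactV \<Omega> a v) = m a (l v) + ractA \<Omega>' a (r v) \<and>
      r (ractV \<Omega> v a) = ractV \<Omega>' (r v) a \<and>
      lactA \<Omega> v a + l (ractV \<Omega> v a) = m (l v) a + lactA \<Omega>' (r v) a) \<and>
    (\<forall>v1\<in>V. \<forall>v2\<in>V.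
      r (multV \<Omega> v1 v2) =
        multV \<Omega>' (r v1) (r v2) + lactV \<Omega>' (l v1) (r v2) + ractV \<Omega>' (r v1) (l v2) \<and>
      chi \<Omega> v1 v2 + l (multV \<Omega> v1 v2) =
        m (l v1) (l v2) + lactA \<Omega>' (r v1) (l v2) + ractA \<Omega>' (l v1) (r v2) + chi \<Omega>' (r v1) (r v2))"

definition datum_equivalent ::
  "('k::field_char_0 \<Rightarrow> 'e \<Rightarrow> 'e) \<Rightarrow> 'e::ab_group_add set \<Rightarrow> ('e \<Rightarrow> 'e \<Rightarrow> 'e) \<Rightarrow> 'e set \<Rightarrow> ('e datum \<times> 'e datum) set"
  where "datum_equivalent s A m V =
    {(\<Omega>, \<Omega>') \<in> perm_ext_structures s A m V \<times> perm_ext_structures s A m V.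
      \<exists>l r. datum_morphism s A m V \<Omega> \<Omega>' l r}"

definition datum_cohomologous ::
  "('k::field_char_0 \<Rightarrow> 'e \<Rightarrow> 'e) \<Rightarrow> 'e::ab_group_add set \<Rightarrow> ('e \<Rightarrow> 'e \<Rightarrow> 'e) \<Rightarrow> 'e set \<Rightarrow> ('e datum \<times> 'e datum) set"
  where "datum_cohomologous s A m V =
    {(\<Omega>, \<Omega>') \<in> perm_ext_structures s A m V \<times> perm_ext_structures s A m V.
      \<exists>l. datum_morphism s A m V \<Omega> \<Omega>' l id}"


section \<open>Perm algebra structures on the ambient space\<close>

text \<open>The ambient space \<open>E\<close> is the whole type. If \<open>A\<close> and \<open>V\<close> are complementary, \<open>decomp A V\<close> is the
  inverse of the isomorphism from \<open>A \<times> V\<close> to \<open>E\<close>.\<close>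

definition decomp :: "'e::ab_group_add set \<Rightarrow> 'e set \<Rightarrow> 'e \<Rightarrow> 'e \<times> 'e"
  where "decomp A V = inv_into (A \<times> V) (\<lambda>(a, v). a + v)"

definition unified_product ::
  "'e::ab_group_add set \<Rightarrow> ('e \<Rightarrow> 'e \<Rightarrow> 'e) \<Rightarrow> 'e set \<Rightarrow> 'e datum \<Rightarrow> 'e \<Rightarrow> 'e \<Rightarrow> 'e"
  where "unified_product A m V \<Omega> x y =
    (\<lambda>(a, v). a + v) (unified_mult m \<Omega> (decomp A V x) (decomp A V y))"

definition projV :: "'e::ab_group_add set \<Rightarrow> 'e set \<Rightarrow> 'e \<Rightarrow> 'e"
  where "projV A V x = snd (decomp A V x)"

definition perm_structures ::
  "('k::field_char_0 \<Rightarrow> 'e \<Rightarrow> 'e) \<Rightarrow> 'e::ab_group_add set \<Rightarrow> ('e \<Rightarrow> 'e \<Rightarrow> 'e) \<Rightarrow> ('e \<Rightarrow> 'e \<Rightarrow> 'e) set"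
  where "perm_structures s A m =
    {d. perm_algebra s UNIV d \<and> (\<forall>a\<in>A. \<forall>b\<in>A. d a b = m a b)}"

definition perm_iso ::
  "('k::field_char_0 \<Rightarrow> 'e \<Rightarrow> 'e) \<Rightarrow> ('e::ab_group_add \<Rightarrow> 'e \<Rightarrow> 'e) \<Rightarrow> ('e \<Rightarrow> 'e \<Rightarrow> 'e) \<Rightarrow> ('e \<Rightarrow> 'e) \<Rightarrow> bool"
  where "perm_iso s d d' f \<longleftrightarrow>
    Vector_Spaces.linear s s f \<and> bij f \<and> (\<forall>x y. f (d x y) = d' (f x) (f y))"

definition stabilizes :: "'e set \<Rightarrow> ('e \<Rightarrow> 'e) \<Rightarrow> bool"
  where "stabilizes A f \<longleftrightarrow> (\<forall>a\<in>A. f a = a)"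

definition costabilizes :: "'e::ab_group_add set \<Rightarrow> 'e set \<Rightarrow> ('e \<Rightarrow> 'e) \<Rightarrow> bool"
  where "costabilizes A V f \<longleftrightarrow> projV A V \<circ> f = projV A V"

definition struct_equivalent ::
  "('k::field_char_0 \<Rightarrow> 'e \<Rightarrow> 'e) \<Rightarrow> 'e::ab_group_add set \<Rightarrow> ('e \<Rightarrow> 'e \<Rightarrow> 'e) \<Rightarrow>
   (('e \<Rightarrow> 'e \<Rightarrow> 'e) \<times> ('e \<Rightarrow> 'e \<Rightarrow> 'e)) set"
  where "struct_equivalent s A m =
    {(d, d') \<in> perm_structures s A m \<times> perm_structures s A m.
      \<exists>f. perm_iso s d d' f \<and> stabilizes A f}"

definition struct_cohomologous ::
  "('k::field_char_0 \<Rightarrow> 'e \<Rightarrow> 'e) \<Rightarrow> 'e::ab_group_add set \<Rightarrow> ('e \<Rightarrow> 'e \<Rightarrow> 'e) \<Rightarrow> 'e set \<Rightarrow>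
   (('e \<Rightarrow> 'e \<Rightarrow> 'e) \<times> ('e \<Rightarrow> 'e \<Rightarrow> 'e)) set"
  where "struct_cohomologous s A m V =
    {(d, d') \<in> perm_structures s A m \<times> perm_structures s A m.
      \<exists>f. perm_iso s d d' f \<and> stabilizes A f \<and> costabilizes A V f}"

end

theory Submission
  imports Defs
begin

text \<open>
  Write \<open>E = A \<oplus> V\<close>. Assigning to an extending structure \<open>\<Omega>\<close> its unified product, regarded as a
  product on \<open>E\<close>, is already a bijection onto the perm algebra structures on \<open>E\<close> that contain \<open>A\<close>
  as a subalgebra, before any quotient is taken
  (\<open>bij_betw_unified_product\<close>): the six maps of \<open>\<Omega>\<close> are the \<open>A\<close>- and \<open>V\<close>-components of the products
  \<open>a v\<close>, \<open>v a\<close> and \<open>v w\<close>. Since the product of two elements of \<open>A\<close> is prescribed, a bilinear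
  product on \<open>E\<close> is determined by these components, and any bilinear choice of them gives such a
  product. The perm identities on \<open>E\<close> are those of the unified product on \<open>A \<times> V\<close>, transported
  along the linear isomorphism \<open>(a, v) \<mapsto> a + v\<close> (\<open>perm_algebra_unified_iff\<close>).

  The linear endomorphisms of \<open>E\<close> that fix \<open>A\<close> pointwise are exactly the maps
  \<open>a + v \<mapsto> (a + \<lambda> v) + \<rho> v\<close> with \<open>\<lambda> : V \<rightarrow> A\<close> and \<open>\<rho> : V \<rightarrow> V\<close> linear. Such a map is bijective iff
  \<open>\<rho>\<close> is, and it is costabilizing iff \<open>\<rho> = id\<close>. By bilinearity its multiplicativity need only be
  tested on pairs from \<open>A\<close> and \<open>V\<close>; on \<open>A \<times> A\<close> it is automatic, and comparing components on the
  other three kinds of pairs gives the six equations relating two data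
  (\<open>datum_morphism_iff_perm_iso\<close>). Hence the bijection carries each relation on data onto
  the corresponding relation on structures. The latter are equivalence relations because isomorphisms
  compose and invert; so the former are too, and the bijection descends to the quotients
  (\<open>bij_betw_quotients\<close>).
\<close>

section \<open>Quotients under a bijection that reflects relations\<close>

lemma bij_betw_quotients:
  assumes F: "bij_betw F X Y" and S: "equiv Y S" and R: "R \<subseteq> X \<times> X"
    and iff: "\<And>x x'. x \<in> X \<Longrightarrow> x' \<in> X \<Longrightarrow> (x, x') \<in> R \<longleftrightarrow> (F x, F x') \<in> S"
  shows "equiv X R"
    and "\<exists>\<Phi>. (\<forall>x\<in>X. \<Phi> (R `` {x}) = S `` {F x}) \<and> bij_betw \<Phi> (X // R) (Y // S)"
proof -
  have FY: "F x \<in> Y" if "x \<in> X" for x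
    using F that by (auto simp: bij_betw_def)
  have SY: "S \<subseteq> Y \<times> Y"
    using S by (simp add: equiv_type)
  show "equiv X R"
  proof (rule equivI)
    show "R \<subseteq> X \<times> X" by (rule R)
    show "refl_on X R"
      using S FY iff R unfolding equiv_def refl_on_def by blast
    show "sym R"
      using S iff R unfolding equiv_def sym_def by blast
    show "trans R"
      using S iff R unfolding equiv_def trans_def by blast
  qed
  have image_class: "F ` (R `` {x}) = S `` {F x}" if x: "x \<in> X" for x
  proof
    show "F ` (R `` {x}) \<subseteq> S `` {F x}"
      using R iff x by blast
    show "S `` {F x} \<subseteq> F ` (R `` {x})"
    proof
      fix y assume y: "y \<in> S `` {F x}"
      then have "y \<in> F ` X"
        using SY F by (auto simp: bij_betw_def)
      then obtain x' where "x' \<in> X" "y = F x'" by blast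
      with y iff x show "y \<in> F ` (R `` {x})" by blast
    qed
  qed
  have "bij_betw ((`) F) (X // R) (Y // S)"
    unfolding bij_betw_def
  proof
    show "inj_on ((`) F) (X // R)"
    proof (rule inj_onI)
      fix P Q assume "P \<in> X // R" "Q \<in> X // R" "F ` P = F ` Q"
      moreover from this have "P \<subseteq> X" "Q \<subseteq> X"
        using R by (auto simp: quotient_def)
      ultimately show "P = Q"
        using F by (meson bij_betw_def inj_on_image_eq_iff)
    qed
    have "F ` X = Y" using F by (simp add: bij_betw_def)
    then show "((`) F) ` (X // R) = Y // S"
      using image_class by (force simp: quotient_def image_iff)
  qed
  with image_class
  show "\<exists>\<Phi>. (\<forall>x\<in>X. \<Phi> (R `` {x}) = S `` {F x}) \<and> bij_betw \<Phi> (X // R) (Y // S)"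
    by blast
qed


section \<open>Linear and bilinear maps on subspaces\<close>

lemma linear_map_onD:
  assumes "linear_map_on s t U W f"
  shows "x \<in> U \<Longrightarrow> f x \<in> W"
    and "x \<in> U \<Longrightarrow> y \<in> U \<Longrightarrow> f (x + y) = f x + f y"
    and "x \<in> U \<Longrightarrow> f (s c x) = t c (f x)"
  using assms by (auto simp: linear_map_on_def)

lemma bilinear_map_on_iff:
  "bilinear_map_on s U W Z f \<longleftrightarrow>
    (\<forall>x\<in>U. \<forall>y\<in>W. f x y \<in> Z) \<and>
    (\<forall>x\<in>U. \<forall>x'\<in>U. \<forall>y\<in>W. f (x + x') y = f x y + f x' y) \<and>
    (\<forall>x\<in>U. \<forall>y\<in>W. \<forall>y'\<in>W. f x (y + y') = f x y + f x y') \<and>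
    (\<forall>c. \<forall>x\<in>U. \<forall>y\<in>W. f (s c x) y = s c (f x y)) \<and>
    (\<forall>c. \<forall>x\<in>U. \<forall>y\<in>W. f x (s c y) = s c (f x y))"
  unfolding bilinear_map_on_def linear_map_on_def Pi_iff by blast

lemma bilinear_map_onD:
  assumes "bilinear_map_on s U W Z f"
  shows "x \<in> U \<Longrightarrow> y \<in> W \<Longrightarrow> f x y \<in> Z"
    and "x \<in> U \<Longrightarrow> x' \<in> U \<Longrightarrow> y \<in> W \<Longrightarrow> f (x + x') y = f x y + f x' y"
    and "x \<in> U \<Longrightarrow> y \<in> W \<Longrightarrow> y' \<in> W \<Longrightarrow> f x (y + y') = f x y + f x y'"
    and "x \<in> U \<Longrightarrow> y \<in> W \<Longrightarrow> f (s c x) y = s c (f x y)"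
    and "x \<in> U \<Longrightarrow> y \<in> W \<Longrightarrow> f x (s c y) = s c (f x y)"
  using assms by (auto simp: bilinear_map_on_iff)

lemma linear_iff_linear_map_on:
  "vector_space s \<Longrightarrow> Vector_Spaces.linear s s f \<longleftrightarrow> linear_map_on s s UNIV UNIV f"
  by (auto simp: Vector_Spaces.linear_iff linear_map_on_def)

text \<open>The image of a perm algebra under a linear map compatible with the products is a perm
  algebra; injectivity plays no role.\<close>

lemma perm_algebra_transfer:
  assumes P: "perm_algebra s C c" and t: "vector_space t" and D: "module.subspace t D"
    and h: "linear_map_on s t C D h" and onto: "h ` C = D"
    and hom: "\<And>x y. x \<in> C \<Longrightarrow> y \<in> C \<Longrightarrow> d (h x) (h y) = h (c x y)"
  shows "perm_algebra t D d"
proof -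
  interpret P: perm_algebra s C c by (rule P)
  interpret T: vector_space t by (rule t)
  note b = bilinear_map_onD[OF P.bilinear_mult]
  note cl = P.subspace_add[OF P.subspace_carrier] P.subspace_scale[OF P.subspace_carrier]
  note h' = linear_map_onD[OF h]
  have add: "h x + h y = h (x + y)" if "x \<in> C" "y \<in> C" for x y
    using h' that by simp
  have scl: "t k (h x) = h (s k x)" if "x \<in> C" for x k
    using h' that by simp
  show ?thesis
  proof
    show "T.subspace D" by (rule D)
    show "bilinear_map_on t D D D d"
      unfolding bilinear_map_on_iff onto[symmetric]
      by (auto simp: add scl hom b cl)
    fix x y z assume "x \<in> D" "y \<in> D" "z \<in> D"
    then obtain x' y' z' where "x' \<in> C" "y' \<in> C" "z' \<in> C" "x = h x'" "y = h y'" "z = h z'"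
      using onto by blast
    then show "d (d x y) z = d x (d y z)" "d x (d y z) = d x (d z y)"
      using P.mult_assoc P.mult_perm by (simp_all add: hom b)
  qed
qed


section \<open>The correspondence between data and structures\<close>

text \<open>A perm algebra \<open>A\<close> whose underlying space has the complement \<open>V\<close> in the ambient space \<open>E\<close>.\<close>

locale complemented_perm_algebra = perm_algebra s A m
  for s :: "'k::field_char_0 \<Rightarrow> 'e::ab_group_add \<Rightarrow> 'e" and A m +
  fixes V :: "'e set"
  assumes subspace_V: "subspace V"
    and A_inter_V: "A \<inter> V = {0}"
    and A_plus_V: "{a + v | a v. a \<in> A \<and> v \<in> V} = UNIV"
begin

abbreviation projA :: "'e \<Rightarrow> 'e"
  where "projA x \<equiv> fst (decomp A V x)"

lemmas closed [simp, intro] =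
  subspace_0[OF subspace_carrier] subspace_0[OF subspace_V]
  subspace_add[OF subspace_carrier] subspace_add[OF subspace_V]
  subspace_diff[OF subspace_carrier] subspace_diff[OF subspace_V]
  subspace_scale[OF subspace_carrier] subspace_scale[OF subspace_V]

lemma m_closed [simp]: "a \<in> A \<Longrightarrow> b \<in> A \<Longrightarrow> m a b \<in> A"
  using bilinear_map_onD(1)[OF bilinear_mult] .

lemma sum_eq_iff:
  assumes "a \<in> A" "a' \<in> A" "v \<in> V" "v' \<in> V"
  shows "a + v = a' + v' \<longleftrightarrow> a = a' \<and> v = v'"
proof
  assume *: "a + v = a' + v'"
  then have "a - a' = v' - v" by (simp add: algebra_simps)
  moreover have "a - a' \<in> A" "v' - v \<in> V" using assms by auto
  ultimately have "a - a' \<in> A \<inter> V" by simp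
  then have "a - a' = 0" using A_inter_V by blast
  with * show "a = a' \<and> v = v'" by simp
qed simp

lemma sum_bij: "bij_betw (\<lambda>(a, v). a + v) (A \<times> V) UNIV"
  unfolding bij_betw_def
proof
  show "inj_on (\<lambda>(a, v). a + v) (A \<times> V)"
    by (rule inj_onI) (auto simp: sum_eq_iff)
  show "(\<lambda>(a, v). a + v) ` (A \<times> V) = UNIV"
    using A_plus_V by (auto simp: image_iff) blast
qed

lemma decomp_sum [simp]: "a \<in> A \<Longrightarrow> v \<in> V \<Longrightarrow> decomp A V (a + v) = (a, v)"
  using inv_into_f_f[OF bij_betw_imp_inj_on[OF sum_bij], of "(a, v)"] by (simp add: decomp_def)

lemma obtain_sum:
  obtains a v where "a \<in> A" "v \<in> V" "x = a + v"
  using A_plus_V by blast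

lemma decomp_A [simp]: "a \<in> A \<Longrightarrow> decomp A V a = (a, 0)"
  using decomp_sum[of a 0] by simp

lemma decomp_V [simp]: "v \<in> V \<Longrightarrow> decomp A V v = (0, v)"
  using decomp_sum[of 0 v] by simp

lemma decomp_eq_iff: "decomp A V x = p \<longleftrightarrow> projA x = fst p \<and> projV A V x = snd p"
  by (simp add: projV_def prod_eq_iff)

lemma projV_simps [simp]:
  "a \<in> A \<Longrightarrow> v \<in> V \<Longrightarrow> projV A V (a + v) = v"
  "a \<in> A \<Longrightarrow> projV A V a = 0" "v \<in> V \<Longrightarrow> projV A V v = v"
  by (simp_all add: projV_def)

lemma proj_in [simp]: "projA x \<in> A" "projV A V x \<in> V"
  by (rule obtain_sum[of x]; simp)+

lemma decomp_in: "decomp A V x \<in> A \<times> V"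
  by (rule obtain_sum[of x]) simp

lemma proj_sum: "projA x + projV A V x = x"
  by (rule obtain_sum[of x]; simp)

lemma proj_add [simp]:
  "projA (x + y) = projA x + projA y" "projV A V (x + y) = projV A V x + projV A V y"
proof -
  have "x + y = (projA x + projA y) + (projV A V x + projV A V y)"
    by (metis (no_types) proj_sum add.assoc add.left_commute)
  then have "decomp A V (x + y) = (projA x + projA y, projV A V x + projV A V y)"
    using decomp_sum[of "projA x + projA y" "projV A V x + projV A V y"] by simp
  then show "projA (x + y) = projA x + projA y" "projV A V (x + y) = projV A V x + projV A V y"
    by (simp_all add: projV_def)
qed

lemma proj_scale [simp]:
  "projA (s c x) = s c (projA x)" "projV A V (s c x) = s c (projV A V x)"
proof -
  have "s c x = s c (projA x) + s c (projV A V x)"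
    by (metis proj_sum scale_right_distrib)
  then have "decomp A V (s c x) = (s c (projA x), s c (projV A V x))"
    using decomp_sum[of "s c (projA x)" "s c (projV A V x)"] by simp
  then show "projA (s c x) = s c (projA x)" "projV A V (s c x) = s c (projV A V x)"
    by (simp_all add: projV_def)
qed

lemma perm_structuresD:
  assumes "d \<in> perm_structures s A m"
  shows "d (x + x') y = d x y + d x' y" "d x (y + y') = d x y + d x y'"
    "d (s c x) y = s c (d x y)" "d x (s c y) = s c (d x y)"
    "a \<in> A \<Longrightarrow> b \<in> A \<Longrightarrow> d a b = m a b"
proof -
  interpret d: perm_algebra s UNIV d
    using assms by (simp add: perm_structures_def)
  note b = bilinear_map_onD[OF d.bilinear_mult]
  show "d (x + x') y = d x y + d x' y" "d x (y + y') = d x y + d x y'"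
    "d (s c x) y = s c (d x y)" "d x (s c y) = s c (d x y)"
    by (simp_all add: b)
  show "a \<in> A \<Longrightarrow> b \<in> A \<Longrightarrow> d a b = m a b"
    using assms by (simp add: perm_structures_def)
qed

lemma extending_datum_closed:
  assumes "extending_datum s A V \<Omega>"
  shows "a \<in> A \<Longrightarrow> v \<in> V \<Longrightarrow> lactV \<Omega> a v \<in> V" "a \<in> A \<Longrightarrow> v \<in> V \<Longrightarrow> ractV \<Omega> v a \<in> V"
    "a \<in> A \<Longrightarrow> v \<in> V \<Longrightarrow> lactA \<Omega> v a \<in> A" "a \<in> A \<Longrightarrow> v \<in> V \<Longrightarrow> ractA \<Omega> a v \<in> A"
    "v \<in> V \<Longrightarrow> w \<in> V \<Longrightarrow> chi \<Omega> v w \<in> A" "v \<in> V \<Longrightarrow> w \<in> V \<Longrightarrow> multV \<Omega> v w \<in> V"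
  using assms by (auto simp: extending_datum_def PiE_iff)

lemma bilinear_map_on_zero:
  assumes "bilinear_map_on s U W Z f"
  shows "0 \<in> U \<Longrightarrow> y \<in> W \<Longrightarrow> f 0 y = 0" "x \<in> U \<Longrightarrow> 0 \<in> W \<Longrightarrow> f x 0 = 0"
  using bilinear_map_onD(4)[OF assms, of 0 y 0] bilinear_map_onD(5)[OF assms, of x 0 0] by simp_all

lemma unified_product_sum:
  assumes "a \<in> A" "b \<in> A" "v \<in> V" "w \<in> V"
  shows "unified_product A m V \<Omega> (a + v) (b + w) =
    (m a b + lactA \<Omega> v b + ractA \<Omega> a w + chi \<Omega> v w) +
    (multV \<Omega> v w + lactV \<Omega> a w + ractV \<Omega> v b)"
  using assms by (simp add: unified_product_def unified_mult_def)

lemma unified_product_generators: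
  assumes "extending_datum s A V \<Omega>" and "a \<in> A" "b \<in> A" "v \<in> V" "w \<in> V"
  shows "unified_product A m V \<Omega> a b = m a b"
    and "unified_product A m V \<Omega> a w = ractA \<Omega> a w + lactV \<Omega> a w"
    and "unified_product A m V \<Omega> v b = lactA \<Omega> v b + ractV \<Omega> v b"
    and "unified_product A m V \<Omega> v w = chi \<Omega> v w + multV \<Omega> v w"
proof -
  have [simp]: "lactV \<Omega> x 0 = 0" "ractV \<Omega> 0 x = 0" "lactA \<Omega> 0 x = 0" "ractA \<Omega> x 0 = 0"
    if "x \<in> A" for x
    using assms(1) that unfolding extending_datum_def by (auto intro: bilinear_map_on_zero)
  have [simp]: "lactV \<Omega> 0 x = 0" "ractV \<Omega> x 0 = 0" "lactA \<Omega> x 0 = 0" "ractA \<Omega> 0 x = 0"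
    "chi \<Omega> x 0 = 0" "chi \<Omega> 0 x = 0" "multV \<Omega> x 0 = 0" "multV \<Omega> 0 x = 0"
    if "x \<in> V" for x
    using assms(1) that unfolding extending_datum_def by (auto intro: bilinear_map_on_zero)
  have [simp]: "m x 0 = 0" "m 0 x = 0" if "x \<in> A" for x
    using that by (auto intro: bilinear_map_on_zero[OF bilinear_mult])
  show "unified_product A m V \<Omega> a b = m a b"
    "unified_product A m V \<Omega> a w = ractA \<Omega> a w + lactV \<Omega> a w"
    "unified_product A m V \<Omega> v b = lactA \<Omega> v b + ractV \<Omega> v b"
    "unified_product A m V \<Omega> v w = chi \<Omega> v w + multV \<Omega> v w"
    using assms unified_product_sum[of a b 0 0 \<Omega>] unified_product_sum[of a 0 0 w \<Omega>]
      unified_product_sum[of 0 b v 0 \<Omega>] unified_product_sum[of 0 0 v w \<Omega>]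
    by simp_all
qed

sublocale prod: vector_space_prod s s ..

lemma perm_algebra_unified_iff:
  assumes "extending_datum s A V \<Omega>"
  shows "perm_algebra prod.scale (A \<times> V) (unified_mult m \<Omega>) \<longleftrightarrow>
    perm_algebra s UNIV (unified_product A m V \<Omega>)"
proof
  note cl = extending_datum_closed[OF assms]
  show "perm_algebra s UNIV (unified_product A m V \<Omega>)"
    if "perm_algebra prod.scale (A \<times> V) (unified_mult m \<Omega>)"
  proof (rule perm_algebra_transfer[OF that])
    show "vector_space s" ..
    show "linear_map_on prod.scale s (A \<times> V) UNIV (\<lambda>(a, v). a + v)"
      by (auto simp: linear_map_on_def prod.scale_def scale_right_distrib algebra_simps)
    show "(\<lambda>(a, v). a + v) ` (A \<times> V) = UNIV"
      using sum_bij by (simp add: bij_betw_def)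
    show "unified_product A m V \<Omega> ((\<lambda>(a, v). a + v) p) ((\<lambda>(a, v). a + v) q) =
        (\<lambda>(a, v). a + v) (unified_mult m \<Omega> p q)" if "p \<in> A \<times> V" "q \<in> A \<times> V" for p q
      using that by (auto simp: unified_product_def)
  qed simp
  show "perm_algebra prod.scale (A \<times> V) (unified_mult m \<Omega>)"
    if "perm_algebra s UNIV (unified_product A m V \<Omega>)"
  proof (rule perm_algebra_transfer[OF that])
    show "vector_space prod.scale" ..
    show "prod.p.subspace (A \<times> V)"
      by (rule prod.subspace_Times[OF subspace_carrier subspace_V])
    show "linear_map_on s prod.scale UNIV (A \<times> V) (decomp A V)"
      by (simp add: linear_map_on_def decomp_in decomp_eq_iff prod.scale_def flip: projV_def)
    show "range (decomp A V) = A \<times> V"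
    proof
      show "range (decomp A V) \<subseteq> A \<times> V" using decomp_in by blast
      show "A \<times> V \<subseteq> range (decomp A V)"
      proof
        fix p assume "p \<in> A \<times> V"
        then have "p = decomp A V (fst p + snd p)" by auto
        then show "p \<in> range (decomp A V)" by blast
      qed
    qed
    show "unified_mult m \<Omega> (decomp A V x) (decomp A V y) =
        decomp A V (unified_product A m V \<Omega> x y)" for x y
      by (rule obtain_sum[of x], rule obtain_sum[of y])
        (simp add: unified_product_def unified_mult_def cl)
  qed
qed

lemma unified_product_in_structures:
  assumes "\<Omega> \<in> perm_ext_structures s A m V"
  shows "unified_product A m V \<Omega> \<in> perm_structures s A m"
  using assms perm_algebra_unified_iff unified_product_generators(1)[where v = 0 and w = 0]
  by (auto simp: perm_ext_structures_def perm_structures_def)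

text \<open>The datum read off from a product \<open>d\<close> on \<open>E\<close>: the components of the products of elements of
  \<open>A\<close> and \<open>V\<close>, with the value \<^term>\<open>undefined\<close> outside the respective domains.\<close>

definition datum_of :: "('e \<Rightarrow> 'e \<Rightarrow> 'e) \<Rightarrow> 'e datum"
  where "datum_of d =
    \<lparr>lactV = (\<lambda>a v. if a \<in> A \<and> v \<in> V then projV A V (d a v) else undefined),
     ractV = (\<lambda>v a. if v \<in> V \<and> a \<in> A then projV A V (d v a) else undefined),
     lactA = (\<lambda>v a. if v \<in> V \<and> a \<in> A then projA (d v a) else undefined),
     ractA = (\<lambda>a v. if a \<in> A \<and> v \<in> V then projA (d a v) else undefined),
     chi = (\<lambda>v w. if v \<in> V \<and> w \<in> V then projA (d v w) else undefined),
     multV = (\<lambda>v w. if v \<in> V \<and> w \<in> V then projV A V (d v w) else undefined)\<rparr>"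

lemma extending_datum_datum_of:
  assumes "d \<in> perm_structures s A m"
  shows "extending_datum s A V (datum_of d)"
  unfolding extending_datum_def datum_of_def bilinear_map_on_iff
  by (auto simp: perm_structuresD[OF assms] PiE_iff extensional_def)

lemma unified_product_datum_of:
  assumes "d \<in> perm_structures s A m"
  shows "unified_product A m V (datum_of d) = d"
proof (intro ext)
  fix x y
  obtain a v where x: "a \<in> A" "v \<in> V" "x = a + v" by (rule obtain_sum)
  obtain b w where y: "b \<in> A" "w \<in> V" "y = b + w" by (rule obtain_sum)
  have "d x y = m a b + d a w + d v b + d v w"
    using x y by (simp add: perm_structuresD[OF assms] algebra_simps)
  also have "\<dots> = m a b + (projA (d a w) + projV A V (d a w)) +
      (projA (d v b) + projV A V (d v b)) + (projA (d v w) + projV A V (d v w))"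
    by (simp only: proj_sum)
  also have "\<dots> = unified_product A m V (datum_of d) x y"
    using x y by (simp add: unified_product_sum) (simp add: datum_of_def algebra_simps)
  finally show "unified_product A m V (datum_of d) x y = d x y" ..
qed

lemma case_prod_PiE_arb:
  "case_prod f \<in> B \<times> C \<rightarrow>\<^sub>E D \<Longrightarrow> \<not> (x \<in> B \<and> y \<in> C) \<Longrightarrow> f x y = undefined"
  using PiE_arb[of "case_prod f" "B \<times> C" "\<lambda>_. D" "(x, y)"] by simp

lemma datum_of_unified_product:
  assumes "extending_datum s A V \<Omega>"
  shows "datum_of (unified_product A m V \<Omega>) = \<Omega>"
proof -
  note cl = extending_datum_closed[OF assms]
  have "case_prod (lactV \<Omega>) \<in> A \<times> V \<rightarrow>\<^sub>E V" "case_prod (ractV \<Omega>) \<in> V \<times> A \<rightarrow>\<^sub>E V"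
    "case_prod (lactA \<Omega>) \<in> V \<times> A \<rightarrow>\<^sub>E A" "case_prod (ractA \<Omega>) \<in> A \<times> V \<rightarrow>\<^sub>E A"
    "case_prod (chi \<Omega>) \<in> V \<times> V \<rightarrow>\<^sub>E A" "case_prod (multV \<Omega>) \<in> V \<times> V \<rightarrow>\<^sub>E V"
    using assms by (simp_all add: extending_datum_def)
  note outside = this[THEN case_prod_PiE_arb]
  have gen: "unified_product A m V \<Omega> a v = ractA \<Omega> a v + lactV \<Omega> a v"
    "unified_product A m V \<Omega> v a = lactA \<Omega> v a + ractV \<Omega> v a" if "a \<in> A" "v \<in> V" for a v
    using unified_product_generators(2,3)[OF assms, of a a v v] that by simp_all
  have gen': "unified_product A m V \<Omega> v w = chi \<Omega> v w + multV \<Omega> v w"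
    if "v \<in> V" "w \<in> V" for v w
    using unified_product_generators(4)[OF assms, of 0 0 v w] that by simp
  show ?thesis
    by (rule datum.equality)
      (auto simp: datum_of_def fun_eq_iff gen gen' cl outside)
qed

lemma bij_betw_unified_product:
  "bij_betw (unified_product A m V) (perm_ext_structures s A m V) (perm_structures s A m)"
proof (rule bij_betw_byWitness[where f' = datum_of])
  show "\<forall>\<Omega>\<in>perm_ext_structures s A m V. datum_of (unified_product A m V \<Omega>) = \<Omega>"
    by (simp add: perm_ext_structures_def datum_of_unified_product)
  show "\<forall>d\<in>perm_structures s A m. unified_product A m V (datum_of d) = d"
    by (simp add: unified_product_datum_of)
  show "unified_product A m V ` perm_ext_structures s A m V \<subseteq> perm_structures s A m"
    using unified_product_in_structures by blast
  show "datum_of ` perm_structures s A m \<subseteq> perm_ext_structures s A m V"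
    using extending_datum_datum_of
    by (auto simp: perm_ext_structures_def perm_algebra_unified_iff unified_product_datum_of)
      (simp add: perm_structures_def)
qed


section \<open>Morphisms of data and isomorphisms that stabilize A\<close>

text \<open>The map \<open>a + v \<mapsto> (a + l v) + r v\<close> on \<open>E\<close>; only the values of \<open>l\<close> and \<open>r\<close> on \<open>V\<close> matter.\<close>

definition extend :: "('e \<Rightarrow> 'e) \<Rightarrow> ('e \<Rightarrow> 'e) \<Rightarrow> 'e \<Rightarrow> 'e"
  where "extend l r x = (projA x + l (projV A V x)) + r (projV A V x)"

context
  fixes l r
  assumes l: "linear_map_on s s V A l" and r: "linear_map_on s s V V r"
begin

lemmas lr = linear_map_onD[OF l] linear_map_onD[OF r]

lemma lr_zero: "l 0 = 0" "r 0 = 0"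
  using lr(3)[of 0 0] lr(6)[of 0 0] by simp_all

lemma extend_sum: "a \<in> A \<Longrightarrow> v \<in> V \<Longrightarrow> extend l r (a + v) = (a + l v) + r v"
  by (simp add: extend_def)

lemma extend_A: "a \<in> A \<Longrightarrow> extend l r a = a"
  and extend_V: "v \<in> V \<Longrightarrow> extend l r v = l v + r v"
  using extend_sum[of a 0] extend_sum[of 0 v] by (simp_all add: lr_zero)

lemma linear_map_on_extend: "linear_map_on s s UNIV UNIV (extend l r)"
  unfolding linear_map_on_def extend_def by (simp add: lr scale_right_distrib algebra_simps)

lemma bij_extend_iff: "bij (extend l r) \<longleftrightarrow> bij_betw r V V"
proof
  note [simp] = lr
  assume bij: "bij (extend l r)"
  show "bij_betw r V V"
    unfolding bij_betw_def
  proof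
    show "inj_on r V"
    proof (rule inj_onI)
      fix v w assume vw: "v \<in> V" "w \<in> V" "r v = r w"
      \<comment> \<open>The images of \<open>v\<close> and \<open>w\<close> differ only by \<open>l w - l v\<close>, an element of \<open>A\<close> and so its own image.\<close>
      then have "extend l r ((l w - l v) + v) = extend l r (0 + w)"
        by (subst (1 2) extend_sum) auto
      then have "(l w - l v) + v = 0 + w"
        using bij by (simp only: bij_def inj_eq)
      then show "v = w" using vw by (subst (asm) sum_eq_iff) auto
    qed
    show "r ` V = V"
    proof
      show "r ` V \<subseteq> V" by auto
      show "V \<subseteq> r ` V"
      proof
        fix w assume w: "w \<in> V"
        obtain x where x: "w = extend l r x" using bij by (metis bij_def surjD)
        obtain a v where "a \<in> A" "v \<in> V" "x = a + v" by (rule obtain_sum)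
        with x w have "0 + w = (a + l v) + r v" by (simp add: extend_sum)
        then have "w = r v" using \<open>a \<in> A\<close> \<open>v \<in> V\<close> w by (subst (asm) sum_eq_iff) auto
        then show "w \<in> r ` V" using \<open>v \<in> V\<close> by blast
      qed
    qed
  qed
next
  note [simp] = lr
  assume bij: "bij_betw r V V"
  show "bij (extend l r)"
  proof (rule bijI)
    show "inj (extend l r)"
    proof (rule injI)
      fix x y assume eq: "extend l r x = extend l r y"
      obtain a v where x: "a \<in> A" "v \<in> V" "x = a + v" by (rule obtain_sum)
      obtain b w where y: "b \<in> A" "w \<in> V" "y = b + w" by (rule obtain_sum)
      have *: "a + l v = b + l w" "r v = r w"
        using eq x y by (simp_all add: extend_sum sum_eq_iff)
      then have "v = w" using bij x y by (metis bij_betw_def inj_onD)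
      with * x y show "x = y" by simp
    qed
    show "surj (extend l r)"
    proof (rule surjI)
      fix y
      let ?v = "inv_into V r (projV A V y)"
      have "?v \<in> V" "r ?v = projV A V y"
        using bij by (simp_all add: bij_betw_def inv_into_into f_inv_into_f)
      then show "extend l r ((projA y - l ?v) + ?v) = y"
        by (subst extend_sum) (auto simp: proj_sum)
    qed
  qed
qed

text \<open>Multiplicativity of \<open>extend l r\<close> on \<open>A \<times> V\<close>, on \<open>V \<times> A\<close> and on \<open>V \<times> V\<close> amounts, in each case, to
  two of the six equations defining a morphism of data: one in \<open>A\<close> and one in \<open>V\<close>.\<close>

lemma datum_morphism_iff_generators:
  assumes \<Omega>: "extending_datum s A V \<Omega>" and \<Omega>': "extending_datum s A V \<Omega>'"
    and str: "unified_product A m V \<Omega>' \<in> perm_structures s A m"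
  defines "f \<equiv> extend l r" and "d \<equiv> unified_product A m V \<Omega>" and "d' \<equiv> unified_product A m V \<Omega>'"
  shows "datum_morphism s A m V \<Omega> \<Omega>' l r \<longleftrightarrow> bij_betw r V V \<and>
    (\<forall>a\<in>A. \<forall>v\<in>V. f (d a v) = d' (f a) (f v) \<and> f (d v a) = d' (f v) (f a)) \<and>
    (\<forall>v\<in>V. \<forall>w\<in>V. f (d v w) = d' (f v) (f w))"
proof -
  note cl = extending_datum_closed[OF \<Omega>] extending_datum_closed[OF \<Omega>']
  note [simp] = lr lr_zero
  note gen = unified_product_generators[OF \<Omega>]
  have AV: "f (d a v) = d' (f a) (f v) \<longleftrightarrow>
      ractA \<Omega> a v + l (lactV \<Omega> a v) = m a (l v) + ractA \<Omega>' a (r v) \<and>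
      r (lactV \<Omega> a v) = lactV \<Omega>' a (r v)"
    and VA: "f (d v a) = d' (f v) (f a) \<longleftrightarrow>
      lactA \<Omega> v a + l (ractV \<Omega> v a) = m (l v) a + lactA \<Omega>' (r v) a \<and>
      r (ractV \<Omega> v a) = ractV \<Omega>' (r v) a" if "a \<in> A" "v \<in> V" for a v
  proof -
    have f: "f (d a v) = (ractA \<Omega> a v + l (lactV \<Omega> a v)) + r (lactV \<Omega> a v)"
      "f (d v a) = (lactA \<Omega> v a + l (ractV \<Omega> v a)) + r (ractV \<Omega> v a)"
      using that gen(2)[of a a v v] gen(3)[of a a v v] by (simp_all add: f_def d_def extend_sum cl)
    have d': "d' (f a) (f v) = (m a (l v) + ractA \<Omega>' a (r v)) + lactV \<Omega>' a (r v)"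
      "d' (f v) (f a) = (m (l v) a + lactA \<Omega>' (r v) a) + ractV \<Omega>' (r v) a"
      using that unified_product_generators[OF \<Omega>', of a "l v" "r v" "r v"]
        unified_product_generators[OF \<Omega>', of "l v" a "r v" "r v"]
      by (simp_all add: f_def d'_def extend_A extend_V perm_structuresD(1,2)[OF str] algebra_simps)
    show "f (d a v) = d' (f a) (f v) \<longleftrightarrow>
      ractA \<Omega> a v + l (lactV \<Omega> a v) = m a (l v) + ractA \<Omega>' a (r v) \<and>
      r (lactV \<Omega> a v) = lactV \<Omega>' a (r v)"
      "f (d v a) = d' (f v) (f a) \<longleftrightarrow>
      lactA \<Omega> v a + l (ractV \<Omega> v a) = m (l v) a + lactA \<Omega>' (r v) a \<and>
      r (ractV \<Omega> v a) = ractV \<Omega>' (r v) a"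
      unfolding f d' using that by (simp_all add: sum_eq_iff cl)
  qed
  have VV: "f (d v w) = d' (f v) (f w) \<longleftrightarrow>
      chi \<Omega> v w + l (multV \<Omega> v w) =
        m (l v) (l w) + lactA \<Omega>' (r v) (l w) + ractA \<Omega>' (l v) (r w) + chi \<Omega>' (r v) (r w) \<and>
      r (multV \<Omega> v w) =
        multV \<Omega>' (r v) (r w) + lactV \<Omega>' (l v) (r w) + ractV \<Omega>' (r v) (l w)"
    if "v \<in> V" "w \<in> V" for v w
  proof -
    have f: "f (d v w) = (chi \<Omega> v w + l (multV \<Omega> v w)) + r (multV \<Omega> v w)"
      using that gen(4)[of 0 0 v w] by (simp add: f_def d_def extend_sum cl)
    have d': "d' (f v) (f w) =
      (m (l v) (l w) + lactA \<Omega>' (r v) (l w) + ractA \<Omega>' (l v) (r w) + chi \<Omega>' (r v) (r w)) +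
      (multV \<Omega>' (r v) (r w) + lactV \<Omega>' (l v) (r w) + ractV \<Omega>' (r v) (l w))"
      using that by (simp add: f_def d'_def extend_V unified_product_sum)
    show ?thesis
      unfolding f d' using that by (simp add: sum_eq_iff cl)
  qed
  show ?thesis
    unfolding datum_morphism_def by (simp add: AV VA VV l r) blast
qed

lemma datum_morphism_iff_perm_iso:
  assumes "\<Omega> \<in> perm_ext_structures s A m V" "\<Omega>' \<in> perm_ext_structures s A m V"
  shows "datum_morphism s A m V \<Omega> \<Omega>' l r \<longleftrightarrow>
    perm_iso s (unified_product A m V \<Omega>) (unified_product A m V \<Omega>') (extend l r)"
    (is "_ \<longleftrightarrow> perm_iso s ?d ?d' ?f")
proof -
  have str: "?d \<in> perm_structures s A m" "?d' \<in> perm_structures s A m"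
    using assms by (simp_all add: unified_product_in_structures)
  note d = perm_structuresD[OF str(1)] and d' = perm_structuresD[OF str(2)]
  have add: "?f (x + y) = ?f x + ?f y" for x y
    using linear_map_onD(2)[OF linear_map_on_extend] by simp
  have AA: "?f (?d a b) = ?d' (?f a) (?f b)" if "a \<in> A" "b \<in> A" for a b
    using that by (simp add: extend_A d(5) d'(5))
  have all: "(\<forall>x y. ?f (?d x y) = ?d' (?f x) (?f y)) \<longleftrightarrow>
    (\<forall>a\<in>A. \<forall>v\<in>V. ?f (?d a v) = ?d' (?f a) (?f v) \<and> ?f (?d v a) = ?d' (?f v) (?f a)) \<and>
    (\<forall>v\<in>V. \<forall>w\<in>V. ?f (?d v w) = ?d' (?f v) (?f w))" (is "?L \<longleftrightarrow> ?R")
  proof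
    assume R: ?R
    show ?L
    proof (intro allI)
      fix x y
      obtain a v where x: "a \<in> A" "v \<in> V" "x = a + v" by (rule obtain_sum)
      obtain b w where y: "b \<in> A" "w \<in> V" "y = b + w" by (rule obtain_sum)
      have "?f (?d x y) = ?f (?d a b) + ?f (?d a w) + (?f (?d v b) + ?f (?d v w))"
        unfolding x(3) y(3) by (simp only: d(1,2) add ac_simps)
      also have "\<dots> = ?d' (?f a) (?f b) + ?d' (?f a) (?f w) + (?d' (?f v) (?f b) + ?d' (?f v) (?f w))"
        using R x y AA by simp
      also have "\<dots> = ?d' (?f x) (?f y)"
        unfolding x(3) y(3) by (simp only: d'(1,2) add ac_simps)
      finally show "?f (?d x y) = ?d' (?f x) (?f y)" .
    qed
  qed simp
  have "vector_space s" ..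
  then show ?thesis
    using assms datum_morphism_iff_generators[OF _ _ str(2), of \<Omega>] linear_map_on_extend
    unfolding perm_iso_def all bij_extend_iff
    by (simp add: linear_iff_linear_map_on perm_ext_structures_def)
qed

lemma stabilizes_extend: "stabilizes A (extend l r)"
  by (simp add: stabilizes_def extend_A)

end

lemma linear_map_on_id: "linear_map_on s s V V id"
  by (simp add: linear_map_on_def)

lemma costabilizes_extend_id:
  assumes "linear_map_on s s V A l"
  shows "costabilizes A V (extend l id)"
  using linear_map_onD(1)[OF assms] by (simp add: costabilizes_def fun_eq_iff extend_def)

text \<open>Every linear endomorphism that fixes \<open>A\<close> pointwise has the above form, with the components of
  its restriction to \<open>V\<close> as \<open>l\<close> and \<open>r\<close>.\<close>

lemma linear_stabilizes_imp_extend: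
  assumes f: "linear_map_on s s UNIV UNIV f" and st: "stabilizes A f"
  shows "linear_map_on s s V A (\<lambda>v. projA (f v))"
    and "linear_map_on s s V V (\<lambda>v. projV A V (f v))"
    and "f = extend (\<lambda>v. projA (f v)) (\<lambda>v. projV A V (f v))"
proof -
  note f' = linear_map_onD(2,3)[OF f, simplified]
  show "linear_map_on s s V A (\<lambda>v. projA (f v))"
    "linear_map_on s s V V (\<lambda>v. projV A V (f v))"
    by (simp_all add: linear_map_on_def f')
  show "f = extend (\<lambda>v. projA (f v)) (\<lambda>v. projV A V (f v))"
  proof
    fix x
    have "f x = f (projA x) + f (projV A V x)"
      using f'(1)[of "projA x" "projV A V x"] by (simp add: proj_sum)
    then show "f x = extend (\<lambda>v. projA (f v)) (\<lambda>v. projV A V (f v)) x"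
      using st by (simp add: extend_def stabilizes_def proj_sum add.assoc)
  qed
qed

lemma costabilizes_imp_extend_id:
  assumes f: "linear_map_on s s UNIV UNIV f" and st: "stabilizes A f" "costabilizes A V f"
  shows "f = extend (\<lambda>v. projA (f v)) id"
proof
  fix x
  have "projV A V (f (projV A V x)) = projV A V x"
    using st(2) by (metis comp_apply costabilizes_def proj_in(2) projV_simps(3))
  then show "f x = extend (\<lambda>v. projA (f v)) id x"
    using fun_cong[OF linear_stabilizes_imp_extend(3)[OF f st(1)], of x] by (simp add: extend_def)
qed


section \<open>Comparison of the relations\<close>

lemma perm_iso_linear: "perm_iso s d d' f \<Longrightarrow> linear_map_on s s UNIV UNIV f"
  using vector_space_axioms by (simp add: perm_iso_def linear_iff_linear_map_on)

lemma datum_equivalent_iff: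
  assumes "\<Omega> \<in> perm_ext_structures s A m V" "\<Omega>' \<in> perm_ext_structures s A m V"
  shows "(\<Omega>, \<Omega>') \<in> datum_equivalent s A m V \<longleftrightarrow>
    (unified_product A m V \<Omega>, unified_product A m V \<Omega>') \<in> struct_equivalent s A m"
proof -
  have "(\<exists>l r. datum_morphism s A m V \<Omega> \<Omega>' l r) \<longleftrightarrow>
    (\<exists>f. perm_iso s (unified_product A m V \<Omega>) (unified_product A m V \<Omega>') f \<and> stabilizes A f)"
  proof
    assume "\<exists>l r. datum_morphism s A m V \<Omega> \<Omega>' l r"
    then obtain l r where lr: "datum_morphism s A m V \<Omega> \<Omega>' l r" by blast
    then have "linear_map_on s s V A l" "linear_map_on s s V V r"
      by (simp_all add: datum_morphism_def)
    with lr assms show "\<exists>f. perm_iso s (unified_product A m V \<Omega>) (unified_product A m V \<Omega>') f \<and>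
        stabilizes A f"
      using datum_morphism_iff_perm_iso stabilizes_extend by blast
  next
    assume "\<exists>f. perm_iso s (unified_product A m V \<Omega>) (unified_product A m V \<Omega>') f \<and> stabilizes A f"
    then obtain f where f: "perm_iso s (unified_product A m V \<Omega>) (unified_product A m V \<Omega>') f"
      "stabilizes A f" by blast
    note ext = linear_stabilizes_imp_extend[OF perm_iso_linear[OF f(1)] f(2)]
    show "\<exists>l r. datum_morphism s A m V \<Omega> \<Omega>' l r"
      using datum_morphism_iff_perm_iso[OF ext(1,2) assms] f(1) ext(3) by auto
  qed
  then show ?thesis
    using assms by (simp add: datum_equivalent_def struct_equivalent_def unified_product_in_structures)
qed

lemma datum_cohomologous_iff:
  assumes "\<Omega> \<in> perm_ext_structures s A m V" "\<Omega>' \<in> perm_ext_structures s A m V"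
  shows "(\<Omega>, \<Omega>') \<in> datum_cohomologous s A m V \<longleftrightarrow>
    (unified_product A m V \<Omega>, unified_product A m V \<Omega>') \<in> struct_cohomologous s A m V"
proof -
  have "(\<exists>l. datum_morphism s A m V \<Omega> \<Omega>' l id) \<longleftrightarrow>
    (\<exists>f. perm_iso s (unified_product A m V \<Omega>) (unified_product A m V \<Omega>') f \<and>
      stabilizes A f \<and> costabilizes A V f)"
  proof
    assume "\<exists>l. datum_morphism s A m V \<Omega> \<Omega>' l id"
    then obtain l where l: "datum_morphism s A m V \<Omega> \<Omega>' l id" by blast
    then have "linear_map_on s s V A l"
      by (simp add: datum_morphism_def)
    with l assms show "\<exists>f. perm_iso s (unified_product A m V \<Omega>) (unified_product A m V \<Omega>') f \<and>
        stabilizes A f \<and> costabilizes A V f"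
      using datum_morphism_iff_perm_iso stabilizes_extend costabilizes_extend_id linear_map_on_id
      by blast
  next
    assume "\<exists>f. perm_iso s (unified_product A m V \<Omega>) (unified_product A m V \<Omega>') f \<and>
      stabilizes A f \<and> costabilizes A V f"
    then obtain f where f: "perm_iso s (unified_product A m V \<Omega>) (unified_product A m V \<Omega>') f"
      "stabilizes A f" "costabilizes A V f" by blast
    note lin = perm_iso_linear[OF f(1)]
    show "\<exists>l. datum_morphism s A m V \<Omega> \<Omega>' l id"
      using datum_morphism_iff_perm_iso[OF linear_stabilizes_imp_extend(1)[OF lin f(2)]
          linear_map_on_id assms] f(1) costabilizes_imp_extend_id[OF lin f(2,3)] by auto
  qed
  then show ?thesis
    using assms
    by (simp add: datum_cohomologous_def struct_cohomologous_def unified_product_in_structures)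
qed

lemma perm_iso_id: "perm_iso s d d id"
  using vector_space_axioms by (simp add: perm_iso_def linear_iff_linear_map_on linear_map_on_def)

lemma perm_iso_comp: "perm_iso s d d' f \<Longrightarrow> perm_iso s d' d'' g \<Longrightarrow> perm_iso s d d'' (g \<circ> f)"
  using vector_space_axioms
  by (auto simp: perm_iso_def linear_iff_linear_map_on linear_map_on_def intro: bij_comp)

lemma perm_iso_inv:
  assumes "perm_iso s d d' f"
  shows "perm_iso s d' d (inv f)"
proof -
  note lin = linear_map_onD(2,3)[OF perm_iso_linear[OF assms], simplified]
  have bij: "bij f" and hom: "f (d x y) = d' (f x) (f y)" for x y
    using assms by (simp_all add: perm_iso_def)
  have inv: "inv f y = x \<longleftrightarrow> y = f x" for x y
    using bij by (metis bij_inv_eq_iff)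
  have f_inv: "f (inv f y) = y" for y
    using bij by (simp add: bij_is_surj surj_f_inv_f)
  show ?thesis
    using vector_space_axioms bij_imp_bij_inv[OF bij]
    by (simp add: perm_iso_def linear_iff_linear_map_on linear_map_on_def inv lin hom f_inv)
qed

lemma stabilizes_inv: "bij f \<Longrightarrow> stabilizes A f \<Longrightarrow> stabilizes A (inv f)"
  unfolding stabilizes_def by (metis bij_inv_eq_iff)

lemma costabilizes_inv: "bij f \<Longrightarrow> costabilizes A V f \<Longrightarrow> costabilizes A V (inv f)"
  unfolding costabilizes_def by (metis bij_is_surj comp_assoc comp_id surj_iff)

lemma equiv_struct_equivalent: "equiv (perm_structures s A m) (struct_equivalent s A m)"
proof (rule equivI)
  show "struct_equivalent s A m \<subseteq> perm_structures s A m \<times> perm_structures s A m"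
    by (auto simp: struct_equivalent_def)
  have "stabilizes A id" by (simp add: stabilizes_def)
  then show "refl_on (perm_structures s A m) (struct_equivalent s A m)"
    using perm_iso_id by (auto simp: refl_on_def struct_equivalent_def)
  show "sym (struct_equivalent s A m)"
    unfolding sym_def struct_equivalent_def
    using perm_iso_inv stabilizes_inv by (auto simp: perm_iso_def) blast
  have "stabilizes A (g \<circ> f)" if "stabilizes A f" "stabilizes A g" for f g
    using that by (simp add: stabilizes_def)
  then show "trans (struct_equivalent s A m)"
    unfolding trans_def struct_equivalent_def using perm_iso_comp by blast
qed

lemma equiv_struct_cohomologous: "equiv (perm_structures s A m) (struct_cohomologous s A m V)"
proof (rule equivI)
  show "struct_cohomologous s A m V \<subseteq> perm_structures s A m \<times> perm_structures s A m"
    by (auto simp: struct_cohomologous_def)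
  have "stabilizes A id" "costabilizes A V id" by (simp_all add: stabilizes_def costabilizes_def)
  then show "refl_on (perm_structures s A m) (struct_cohomologous s A m V)"
    using perm_iso_id by (auto simp: refl_on_def struct_cohomologous_def)
  show "sym (struct_cohomologous s A m V)"
    unfolding sym_def struct_cohomologous_def
    using perm_iso_inv stabilizes_inv costabilizes_inv by (auto simp: perm_iso_def) blast
  have "stabilizes A (g \<circ> f)" if "stabilizes A f" "stabilizes A g" for f g
    using that by (simp add: stabilizes_def)
  moreover have "costabilizes A V (g \<circ> f)" if "costabilizes A V f" "costabilizes A V g" for f g
    using that by (metis costabilizes_def comp_assoc)
  ultimately show "trans (struct_cohomologous s A m V)"
    unfolding trans_def struct_cohomologous_def using perm_iso_comp by blast
qed

end

section \<open>The classification\<close>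

theorem theorem2p15:
  fixes s :: "'k::field_char_0 \<Rightarrow> 'e::ab_group_add \<Rightarrow> 'e"
    and A V :: "'e set"
    and m :: "'e \<Rightarrow> 'e \<Rightarrow> 'e"
  assumes "vector_space s"
    and "perm_algebra s A m"
    and "module.subspace s V"
    and "A \<inter> V = {0}"
    and "{a + v | a v. a \<in> A \<and> v \<in> V} = UNIV"
  shows
    "(equiv (perm_ext_structures s A m V) (datum_equivalent s A m V) \<and>
      equiv (perm_structures s A m) (struct_equivalent s A m) \<and>
      (\<exists>\<Phi>. (\<forall>\<Omega> \<in> perm_ext_structures s A m V.
               \<Phi> (datum_equivalent s A m V `` {\<Omega>}) =
               struct_equivalent s A m `` {unified_product A m V \<Omega>}) \<and>
            bij_betw \<Phi> (perm_ext_structures s A m V // datum_equivalent s A m V)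
                       (perm_structures s A m // struct_equivalent s A m))) \<and>
     (equiv (perm_ext_structures s A m V) (datum_cohomologous s A m V) \<and>
      equiv (perm_structures s A m) (struct_cohomologous s A m V) \<and>
      (\<exists>\<Phi>. (\<forall>\<Omega> \<in> perm_ext_structures s A m V.
               \<Phi> (datum_cohomologous s A m V `` {\<Omega>}) =
               struct_cohomologous s A m V `` {unified_product A m V \<Omega>}) \<and>
            bij_betw \<Phi> (perm_ext_structures s A m V // datum_cohomologous s A m V)
                       (perm_structures s A m // struct_cohomologous s A m V)))"
proof -
  interpret perm_algebra s A m by (rule assms)
  interpret complemented_perm_algebra s A m V
    by unfold_locales (use assms in auto)
  have "datum_equivalent s A m V \<subseteq> perm_ext_structures s A m V \<times> perm_ext_structures s A m V"
    "datum_cohomologous s A m V \<subseteq> perm_ext_structures s A m V \<times> perm_ext_structures s A m V"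
    by (auto simp: datum_equivalent_def datum_cohomologous_def)
  note approx = bij_betw_quotients[OF bij_betw_unified_product equiv_struct_equivalent
      this(1) datum_equivalent_iff]
    and cohom = bij_betw_quotients[OF bij_betw_unified_product equiv_struct_cohomologous
      this(2) datum_cohomologous_iff]
  show ?thesis
    using approx cohom equiv_struct_equivalent equiv_struct_cohomologous by blast
qed

end
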